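(* Let $x$ be a complex number and $n$ a positive integer such that all quantities below are defined. Then \[ \sum_{k=0}^n\binom{2n-k}{n}\binom{x+k}{k}kH^2_{k}(x)=\frac{x+1}{8}\binom{x+2n+1}{n-1} \Big\{8H_{n+2}^{\langle2\rangle}(x)-4H_{2n}^{\langle2\rangle}(x+1) +8\big[H_{n+2}(x)-H_{2n+1}(x)\big]\big[H_{n+2}(x)-H_{2n+1}(x)-\tfrac{2}{x+1}\big] -\big[H_n(\tfrac{x}{2})-H_n(\tfrac{x+1}{2})\big]\big[H_n(\tfrac{x}{2})-H_n(\tfrac{x+1}{2})+\tfrac{4}{n}\big]\Big\}. \]
   Context: For a complex $y$ and an integer $k\ge 0$, $\binom{y}{k}=\frac{y(y-1)\cdots(y-k+1)}{k!}$. For complex $x$, integer $n\ge 0$ and positive integer $\ell$: $H_0^{\langle\ell\rangle}(x)=0$, $H_n^{\langle\ell\rangle}(x)=\sum_{k=1}^n\frac{1}{(x+k)^\ell}$, and $H_n(x)=H_n^{\langle1\rangle}(x)$; $H_n^2(x)$ denotes $(H_n(x))^2$. *)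

theory Defs
  imports Complex_Main
begin

definition gharm :: "nat \<Rightarrow> nat \<Rightarrow> complex \<Rightarrow> complex" where
  "gharm l n x = (\<Sum>k = 1..n. 1 / (x + of_nat k) ^ l)"

abbreviation gharm1 :: "nat \<Rightarrow> complex \<Rightarrow> complex" where
  "gharm1 \<equiv> gharm 1"

end

theory Submission
  imports Defs
begin

text \<open>
  Write \<open>p\<^sub>k = binom (x + k) k\<close>, \<open>H\<^sub>k = gharm1 k x\<close> and
  \<open>U\<^sub>n = \<Sum>\<^sub>k k \<cdot> binom (2n - k) n \<cdot> p\<^sub>k g\<^sub>k\<close>.  For \<open>g = 1\<close> the summand has a creative-telescoping
  certificate in \<open>n\<close>; multiplying it by an arbitrary \<open>g\<close> and summing by parts gives a first-order
  recurrence for \<open>U\<^sub>n\<close> whose inhomogeneity carries \<open>(x + k + 1) (g\<^sub>k\<^sub>+\<^sub>1 - g\<^sub>k)\<close>.  For \<open>g = H\<^sup>2\<close>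
  this factor is \<open>2 H\<^sub>k + 1 / (x + k + 1)\<close>.  The first part is summed by the harmonic analogue
  of the Vandermonde convolution.  The second part reduces to \<open>\<Sum>\<^sub>k binom (2n - k) n \<cdot> p\<^sub>k / (x + k + 1)\<close>,
  which satisfies a first-order recurrence of the same kind; its solution produces the difference
  \<open>H\<^sub>n(x/2) - H\<^sub>n((x+1)/2)\<close>.
\<close>

section \<open>Harmonic numbers and contiguity relations of generalized binomials\<close>

lemma gharm_0 [simp]: "gharm l 0 x = 0"
  by (simp add: gharm_def)

lemma gharm_Suc: "gharm l (Suc n) x = gharm l n x + 1 / (x + of_nat (Suc n)) ^ l"
  by (simp add: gharm_def)

lemma gharm_Suc_shift: "gharm l (Suc n) x = 1 / (x + 1) ^ l + gharm l n (x + 1)"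
  by (induction n) (simp_all add: gharm_Suc algebra_simps)

lemma gbinomial_Suc_lower:
  fixes a :: "'a::field_char_0"
  shows "of_nat (Suc k) * (a gchoose Suc k) = (a - of_nat k) * (a gchoose k)"
  by (simp add: gbinomial_mult_1[of a k] algebra_simps)

lemma gbinomial_add_1_upper:
  fixes a :: "'a::field_char_0"
  shows "(a + 1 - of_nat k) * ((a + 1) gchoose k) = (a + 1) * (a gchoose k)"
  using gbinomial_absorb_comp[of "a + 1" k] by simp

lemma gbinomial_diagonal_Suc:
  fixes x :: "'a::field_char_0"
  shows "of_nat (Suc k) * ((x + of_nat (Suc k)) gchoose Suc k)
    = (x + of_nat k + 1) * ((x + of_nat k) gchoose k)"
  using gbinomial_factors[of "x + of_nat k" k]
  by (simp add: field_simps del: of_nat_Suc) (simp add: algebra_simps)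

text \<open>Used to remove a weight k from a sum over \<open>(x + k) gchoose k\<close>: the weight
  is absorbed by lowering the index and replacing x by x + 1.\<close>

lemma gbinomial_diagonal_absorb:
  fixes x :: "'a::field_char_0"
  shows "of_nat (Suc k) * ((x + of_nat (Suc k)) gchoose Suc k)
    = (x + 1) * ((x + 1 + of_nat k) gchoose k)"
proof -
  have "(x + 1) * ((x + 1 + of_nat k) gchoose k) = (x + of_nat k + 1) * ((x + of_nat k) gchoose k)"
    using gbinomial_add_1_upper[of "x + of_nat k" k] by (simp add: algebra_simps)
  then show ?thesis
    by (simp only: gbinomial_diagonal_Suc)
qed

section \<open>Binomial convolutions: Vandermonde's identity and its harmonic analogue\<close>

text \<open>This is the coefficient of t^N in F(t) / (1 - t)^(m + 1), where F generates f. The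
  theorem concerns the diagonal m = N = n, but m and N are kept independent so that induction on
  both is possible and the neighbour m = n + 1, N = n is covered.\<close>

definition binconv :: "(nat \<Rightarrow> complex) \<Rightarrow> nat \<Rightarrow> nat \<Rightarrow> complex" where
  "binconv f m N = (\<Sum>k\<le>N. f k * of_nat ((m + N - k) choose m))"

lemma binconv_0_right [simp]: "binconv f m 0 = f 0"
  by (simp add: binconv_def)

lemma binconv_0_left: "binconv f 0 N = (\<Sum>k\<le>N. f k)"
  by (simp add: binconv_def)

text \<open>Pascal's rule applied to the kernel. A closed form obeying the same rule then follows by
  double induction on m and N.\<close>

lemma binconv_Suc_Suc:
  "binconv f (Suc m) (Suc N) = binconv f (Suc m) N + binconv f m (Suc N)"
proof -
  have "binconv f (Suc m) (Suc N) - binconv f m (Suc N)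
      = (\<Sum>k\<le>Suc N. f k * of_nat ((m + Suc N - k) choose Suc m))"
    unfolding binconv_def sum_subtractf[symmetric]
  proof (rule sum.cong)
    fix k assume "k \<in> {..Suc N}"
    then have "Suc m + Suc N - k = Suc (m + Suc N - k)" by auto
    then show "f k * of_nat ((Suc m + Suc N - k) choose Suc m) - f k * of_nat ((m + Suc N - k) choose m)
      = f k * of_nat ((m + Suc N - k) choose Suc m)"
      by (simp add: algebra_simps)
  qed simp
  \<comment> \<open>The term k = N + 1 drops out because its binomial is
    \<open>m choose Suc m\<close>.\<close>
  also have "\<dots> = binconv f (Suc m) N"
    by (simp add: binconv_def)
  finally show ?thesis by (simp add: algebra_simps)
qed

text \<open>Vandermonde's convolution: \<open>(y + k) gchoose k\<close> is the coefficient of t^k in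
  (1 - t)^(-y - 1), and multiplication by (1 - t)^(-m - 1) only adds exponents.\<close>

lemma binconv_gbinomial:
  "binconv (\<lambda>k. (y + of_nat k) gchoose k) m N = (y + of_nat (m + N) + 1) gchoose N"
proof (induction m arbitrary: N)
  case 0
  show ?case
  proof (induction N)
    case (Suc N)
    have "((y + of_nat N + 1) + 1) gchoose Suc N = ((y + of_nat N + 1) gchoose N) + ((y + of_nat N + 1) gchoose Suc N)"
      by (rule gbinomial_Suc_Suc)
    with Suc show ?case by (simp add: binconv_0_left algebra_simps)
  qed simp
next
  case (Suc m)
  note outer = Suc.IH
  show ?case
  proof (induction N)
    case (Suc N)
    have "((y + of_nat (m + N) + 2) + 1) gchoose Suc N
        = ((y + of_nat (m + N) + 2) gchoose N) + ((y + of_nat (m + N) + 2) gchoose Suc N)"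
      by (rule gbinomial_Suc_Suc)
    with Suc outer[of "Suc N"] show ?case
      by (simp add: binconv_Suc_Suc algebra_simps)
  qed simp
qed

text \<open>The formal derivative of Pascal's rule with respect to the upper argument.\<close>

lemma gbinomial_gharm_Pascal:
  fixes y :: complex
  assumes "y + of_nat (M + 1) \<noteq> 0" "y + of_nat M - of_nat N \<noteq> 0"
  shows "((y + of_nat M + 1) gchoose Suc N) * (d + 1 / (y + of_nat (M + 1)))
    = ((y + of_nat M) gchoose N) * d
      + ((y + of_nat M) gchoose Suc N) * (d + 1 / (y + of_nat M - of_nat N))"
proof -
  have Pascal: "((y + of_nat M + 1) gchoose Suc N)
      = ((y + of_nat M) gchoose N) + ((y + of_nat M) gchoose Suc N)"
    by (rule gbinomial_Suc_Suc)
  define b c s r where "b = ((y + of_nat M) gchoose N)" and "c = ((y + of_nat M) gchoose Suc N)"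
    and "s = y + of_nat M - of_nat N" and "r = (of_nat (Suc N) :: complex)"
  have M: "y + of_nat (M + 1) = s + r" by (simp add: s_def r_def)
  have nz: "s \<noteq> 0" "s + r \<noteq> 0" using assms unfolding M by (auto simp: s_def)
  have "r * c = s * b"
    using gbinomial_Suc_lower[of N "y + of_nat M"] by (simp add: b_def c_def s_def r_def)
  \<comment> \<open>Beyond Pascal's rule itself this is the whole content: the correction on the
    left equals the one carried by the second binomial.\<close>
  then have "(b + c) / (s + r) = c / s"
    using nz by (simp add: field_simps)
  then show ?thesis
    unfolding Pascal M b_def[symmetric] c_def[symmetric] s_def[symmetric]
    by (simp add: algebra_simps add_divide_distrib)
qed

text \<open>The formal derivative of \<open>binconv_gbinomial\<close> in y: differentiating
  \<open>(y + k) gchoose k\<close> produces the factor H_k(y), and the factors y + m + 2, ..., y + m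
  + N + 1 on the right produce the harmonic difference. The double induction is repeated with the
  differentiated Pascal rule.\<close>

lemma binconv_gbinomial_gharm:
  assumes "\<And>k. k \<in> {1..m + N + 1} \<Longrightarrow> y + of_nat k \<noteq> 0"
  shows "binconv (\<lambda>k. ((y + of_nat k) gchoose k) * gharm1 k y) m N
    = ((y + of_nat (m + N) + 1) gchoose N) * (gharm1 (m + N + 1) y - gharm1 (m + 1) y)"
  using assms
proof (induction m arbitrary: N)
  case 0
  then show ?case
  proof (induction N)
    case (Suc N)
    have nz: "y + of_nat k \<noteq> 0" if "k \<in> {1..N + 2}" for k
      using Suc.prems[of k] that by auto
    have d: "gharm1 (0 + N + 1) y - gharm1 (0 + 1) y + 1 / (y + of_nat (N + 1) - of_nat N) = gharm1 (Suc N) y"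
      "gharm1 (0 + N + 1) y - gharm1 (0 + 1) y + 1 / (y + of_nat (N + 1 + 1))
        = gharm1 (0 + Suc N + 1) y - gharm1 (0 + 1) y"
      by (simp_all add: gharm_Suc)
    have y: "y + of_nat (N + 1) = y + of_nat (0 + N) + 1" "y + of_nat (0 + N) + 1 + 1 = y + of_nat (0 + Suc N) + 1"
      by simp_all
    have Pascal: "((y + of_nat (0 + Suc N) + 1) gchoose Suc N) * (gharm1 (0 + Suc N + 1) y - gharm1 (0 + 1) y)
      = ((y + of_nat (0 + N) + 1) gchoose N) * (gharm1 (0 + N + 1) y - gharm1 (0 + 1) y)
       + ((y + of_nat (0 + N) + 1) gchoose Suc N) * gharm1 (Suc N) y"
      unfolding d[symmetric] y[symmetric]
      using nz[of "N + 2"] nz[of 1] by (intro gbinomial_gharm_Pascal) (auto simp: algebra_simps)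
    have "binconv (\<lambda>k. ((y + of_nat k) gchoose k) * gharm1 k y) 0 N
        = ((y + of_nat (0 + N) + 1) gchoose N) * (gharm1 (0 + N + 1) y - gharm1 (0 + 1) y)"
      by (rule Suc.IH, rule nz) simp
    then show ?case
      unfolding Pascal by (simp add: binconv_0_left algebra_simps)
  qed simp
next
  case (Suc m)
  note outer = Suc.IH
  from Suc.prems show ?case
  proof (induction N)
    case (Suc N)
    have nz: "y + of_nat k \<noteq> 0" if "k \<in> {1..m + N + 3}" for k
      using Suc.prems[of k] that by auto
    \<comment> \<open>With d = H_{m+N+2}(y) - H_{m+2}(y), the other two harmonic differences are d
      plus the reciprocals occurring in \<open>gbinomial_gharm_Pascal\<close> for M = m + N +
      2.\<close>
    have d: "gharm1 (Suc m + N + 1) y - gharm1 (Suc m + 1) y + 1 / (y + of_nat (m + N + 2) - of_nat N)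
        = gharm1 (m + Suc N + 1) y - gharm1 (m + 1) y"
      "gharm1 (Suc m + N + 1) y - gharm1 (Suc m + 1) y + 1 / (y + of_nat (m + N + 2 + 1))
        = gharm1 (Suc m + Suc N + 1) y - gharm1 (Suc m + 1) y"
      by (simp_all add: gharm_Suc algebra_simps)
    have y: "y + of_nat (m + N + 2) = y + of_nat (Suc m + N) + 1"
      "y + of_nat (Suc m + N) + 1 + 1 = y + of_nat (Suc m + Suc N) + 1"
      "y + of_nat (m + Suc N) + 1 = y + of_nat (Suc m + N) + 1"
      by simp_all
    have Pascal: "((y + of_nat (Suc m + Suc N) + 1) gchoose Suc N) * (gharm1 (Suc m + Suc N + 1) y - gharm1 (Suc m + 1) y)
      = ((y + of_nat (Suc m + N) + 1) gchoose N) * (gharm1 (Suc m + N + 1) y - gharm1 (Suc m + 1) y)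
       + ((y + of_nat (m + Suc N) + 1) gchoose Suc N) * (gharm1 (m + Suc N + 1) y - gharm1 (m + 1) y)"
      unfolding d[symmetric] y(3) unfolding y(1,2)[symmetric]
      using nz[of "m + N + 3"] nz[of "m + 2"]
      by (intro gbinomial_gharm_Pascal) (auto simp: algebra_simps numeral_3_eq_3)
    moreover have "binconv (\<lambda>k. ((y + of_nat k) gchoose k) * gharm1 k y) (Suc m) N
      = ((y + of_nat (Suc m + N) + 1) gchoose N) * (gharm1 (Suc m + N + 1) y - gharm1 (Suc m + 1) y)"
      by (rule Suc.IH, rule nz) simp
    moreover have "binconv (\<lambda>k. ((y + of_nat k) gchoose k) * gharm1 k y) m (Suc N)
      = ((y + of_nat (m + Suc N) + 1) gchoose Suc N) * (gharm1 (m + Suc N + 1) y - gharm1 (m + 1) y)"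
      by (rule outer, rule nz) simp
    ultimately show ?case
      unfolding binconv_Suc_Suc by (simp only:)
  qed simp
qed

section \<open>Creative telescoping and first-order recurrences in n\<close>

lemma sum_by_parts:
  fixes F g :: "nat \<Rightarrow> 'a::comm_ring"
  shows "(\<Sum>k\<le>N. (F (Suc k) - F k) * g k)
    = F (Suc N) * g (Suc N) - F 0 * g 0 - (\<Sum>k\<le>N. F (Suc k) * (g (Suc k) - g k))"
  by (induction N) (simp_all add: algebra_simps)

text \<open>All binomials of the telescoping certificates are polynomial multiples of a single one, so that
  checking a certificate becomes a polynomial identity.\<close>

lemma binomial_window:
  assumes "k \<le> Suc (Suc m)"
  obtains D :: "'a::field_char_0" where
    "of_nat ((2 * Suc m - k) choose Suc m) = (of_nat m + 2 - of_nat k) * (of_nat m + 2) * D"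
    "of_nat (Suc (2 * Suc m - k) choose Suc m) = (2 * of_nat m + 3 - of_nat k) * (of_nat m + 2) * D"
    "of_nat (Suc (2 * Suc m - k) choose Suc (Suc m))
      = (2 * of_nat m + 3 - of_nat k) * (of_nat m + 2 - of_nat k) * D"
    "of_nat (Suc (Suc (2 * Suc m - k)) choose Suc (Suc m))
      = (2 * of_nat m + 4 - of_nat k) * (2 * of_nat m + 3 - of_nat k) * D"
proof -
  obtain j where j: "Suc (Suc m) = k + j"
    using assms le_Suc_ex by blast
  have e: "2 * Suc m - k = m + j"
    using j by simp
  have k: "(of_nat k :: 'a) = of_nat m + 2 - of_nat j"
    using arg_cong[OF j, of "of_nat :: nat \<Rightarrow> 'a"] by (simp add: algebra_simps)
  have up: "(of_nat b + 1) * of_nat (Suc a choose Suc b) = ((of_nat a + 1) * of_nat (a choose b) :: 'a)" for a b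
    using arg_cong[OF Suc_times_binomial_eq[of a b], of "of_nat :: nat \<Rightarrow> 'a"]
    by (simp add: algebra_simps del: binomial_Suc_Suc)
  have nz: "(of_nat m + 1 :: 'a) \<noteq> 0" "(of_nat m + 2 :: 'a) \<noteq> 0"
  proof -
    have "(of_nat m + 1 :: 'a) = of_nat (Suc m)" "(of_nat m + 2 :: 'a) = of_nat (Suc (Suc m))"
      by simp_all
    then show "(of_nat m + 1 :: 'a) \<noteq> 0" "(of_nat m + 2 :: 'a) \<noteq> 0"
      by (simp_all only: of_nat_neq_0 not_False_eq_True)
  qed
  \<comment> \<open>This normalization clears the denominators of all four binomials. The case j =
    0, that is k = m + 2, is included: there the factor j accounts for the binomials that
    vanish.\<close>
  define D :: 'a where "D = of_nat ((m + j) choose m) / ((of_nat m + 1) * (of_nat m + 2))"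
  have D: "of_nat ((m + j) choose m) = (of_nat m + 1) * (of_nat m + 2) * D"
    using nz by (simp add: D_def)
  have b: "of_nat (Suc (m + j) choose Suc m) = (of_nat m + of_nat j + 1) * (of_nat m + 2) * D"
  proof -
    have "(of_nat m + 1) * of_nat (Suc (m + j) choose Suc m)
        = (of_nat m + 1) * ((of_nat m + of_nat j + 1) * (of_nat m + 2) * D)"
      unfolding up D by (simp add: mult_ac)
    then show ?thesis
      unfolding mult_left_cancel[OF nz(1)] .
  qed
  have a: "of_nat ((m + j) choose Suc m) = of_nat j * (of_nat m + 2) * D"
    using b D by (simp add: algebra_simps)
  have d: "of_nat (Suc (Suc (m + j)) choose Suc (Suc m))
      = (of_nat m + of_nat j + 2) * (of_nat m + of_nat j + 1) * D"
  proof -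
    have "(of_nat m + 2) * of_nat (Suc (Suc (m + j)) choose Suc (Suc m))
        = (of_nat m + 2) * ((of_nat m + of_nat j + 2) * (of_nat m + of_nat j + 1) * D)"
      using up[of "Suc m" "Suc (m + j)"] unfolding b of_nat_Suc of_nat_add
      by (simp add: mult_ac add_ac del: binomial_Suc_Suc)
    then show ?thesis
      unfolding mult_left_cancel[OF nz(2)] .
  qed
  have c: "of_nat (Suc (m + j) choose Suc (Suc m)) = (of_nat m + of_nat j + 1) * of_nat j * D"
  proof -
    have "of_nat (Suc (m + j) choose Suc (Suc m))
        = (of_nat (Suc (Suc (m + j)) choose Suc (Suc m)) - of_nat (Suc (m + j) choose Suc m) :: 'a)"
      unfolding binomial_Suc_Suc[of "Suc (m + j)"] of_nat_add by (simp only: add_diff_cancel_left')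
    then show ?thesis
      unfolding b d by (simp add: algebra_simps)
  qed
  show thesis
    by (rule that[of D]) (simp_all only: e a b c d k, simp_all add: algebra_simps)
qed

text \<open>Puts the sums for n and n + 1 over the same range. The added term has the factor
  \<open>(n - 1) choose n\<close>, which is 0 for n \<ge> 1; at n = 0 truncated subtraction would
  make it 1.\<close>

lemma binconv_diagonal_extend:
  assumes "n \<ge> 1"
  shows "binconv f n n = (\<Sum>k\<le>Suc n. f k * of_nat ((2 * n - k) choose n))"
  using assms by (simp add: binconv_def binomial_eq_0 mult_2)

text \<open>For constant g the recurrence is homogeneous, because its operator turns the summand
  into a difference in k. A general g contributes only its increments, after summation by
  parts.\<close>

lemma binconv_recurrence:
  fixes x :: complex and g :: "nat \<Rightarrow> complex"
  assumes n: "n \<ge> 1"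
  defines "p \<equiv> \<lambda>k. (x + of_nat k) gchoose k"
  shows "(of_nat n + 1) * (x + of_nat n + 2) * binconv (\<lambda>k. p k * g k) (Suc n) (Suc n)
      - (x + 2 * of_nat n + 3) * (x + 2 * of_nat n + 2) * binconv (\<lambda>k. p k * g k) n n
    = binconv (\<lambda>k. p k * (x + of_nat k + 1) * (x + of_nat k + 2) * (g (Suc k) - g k)) n n"
proof -
  \<comment> \<open>The telescoping certificate; its factor k makes the lower boundary term
    vanish.\<close>
  define F where "F k = - of_nat k * p k * (x + of_nat k + 1) * of_nat ((2 * n + 1 - k) choose n)" for k
  have p_Suc: "of_nat (Suc k) * p (Suc k) = (x + of_nat k + 1) * p k" for k
    unfolding p_def by (rule gbinomial_diagonal_Suc)
  have F_Suc: "F (Suc k) = - p k * (x + of_nat k + 1) * (x + of_nat k + 2) * of_nat ((2 * n - k) choose n)" for k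
  proof -
    have "F (Suc k) = - (of_nat (Suc k) * p (Suc k)) * (x + of_nat k + 2) * of_nat ((2 * n - k) choose n)"
      by (simp add: F_def algebra_simps)
    then show ?thesis by (simp only: p_Suc) (simp add: algebra_simps)
  qed
  have step: "(of_nat n + 1) * (x + of_nat n + 2) * (p k * of_nat ((Suc n + Suc n - k) choose Suc n))
      - (x + 2 * of_nat n + 3) * (x + 2 * of_nat n + 2) * (p k * of_nat ((2 * n - k) choose n))
      = F (Suc k) - F k" if k: "k \<le> Suc n" for k
  proof -
    obtain m where m: "n = Suc m" using n by (cases n) auto
    have e: "2 * n + 1 - k = Suc (2 * n - k)" "Suc n + Suc n - k = Suc (Suc (2 * n - k))"
      using k n by auto
    obtain D :: complex where D:
      "of_nat ((2 * Suc m - k) choose Suc m) = (of_nat m + 2 - of_nat k) * (of_nat m + 2) * D"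
      "of_nat (Suc (2 * Suc m - k) choose Suc m) = (2 * of_nat m + 3 - of_nat k) * (of_nat m + 2) * D"
      "of_nat (Suc (2 * Suc m - k) choose Suc (Suc m))
        = (2 * of_nat m + 3 - of_nat k) * (of_nat m + 2 - of_nat k) * D"
      "of_nat (Suc (Suc (2 * Suc m - k)) choose Suc (Suc m))
        = (2 * of_nat m + 4 - of_nat k) * (2 * of_nat m + 3 - of_nat k) * D"
      by (rule binomial_window[OF k[unfolded m]])
    show ?thesis
      unfolding F_Suc unfolding F_def e unfolding m D of_nat_Suc
      by algebra
  qed
  have "(of_nat n + 1) * (x + of_nat n + 2) * binconv (\<lambda>k. p k * g k) (Suc n) (Suc n)
      - (x + 2 * of_nat n + 3) * (x + 2 * of_nat n + 2) * binconv (\<lambda>k. p k * g k) n n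
      = (\<Sum>k\<le>Suc n. (F (Suc k) - F k) * g k)"
    unfolding binconv_diagonal_extend[OF n] unfolding binconv_def sum_distrib_left sum_subtractf[symmetric]
    by (intro sum.cong refl) (simp only: step[symmetric] atMost_iff, simp add: algebra_simps)
  \<comment> \<open>The upper boundary term F(n + 2) contains \<open>(n - 1) choose n\<close> and
    vanishes as well.\<close>
  also have "\<dots> = - (\<Sum>k\<le>Suc n. F (Suc k) * (g (Suc k) - g k))"
    using n by (subst sum_by_parts, subst F_Suc) (simp add: F_def binomial_eq_0)
  also have "\<dots> = binconv (\<lambda>k. p k * (x + of_nat k + 1) * (x + of_nat k + 2) * (g (Suc k) - g k)) n n"
    unfolding binconv_diagonal_extend[OF n] F_Suc sum_negf[symmetric]
    by (intro sum.cong refl) simp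
  finally show ?thesis .
qed

text \<open>The analogue for weight k. The certificate now combines two kernels, with lower indices
  n and n + 1, hence the two convolutions of \<open>d\<close> on the right.\<close>

lemma binconv_recurrence_weighted:
  fixes x :: complex and g :: "nat \<Rightarrow> complex"
  assumes n: "n \<ge> 1"
  defines "p \<equiv> \<lambda>k. (x + of_nat k) gchoose k"
  defines "d \<equiv> \<lambda>k. of_nat k * p k * (x + of_nat k + 1) * (g (Suc k) - g k)"
  shows "of_nat n * (x + of_nat n + 3) * binconv (\<lambda>k. of_nat k * p k * g k) (Suc n) (Suc n)
      - (x + 2 * of_nat n + 3) * (x + 2 * of_nat n + 2) * binconv (\<lambda>k. of_nat k * p k * g k) n n
    = (x + 2 * of_nat n + 3) * binconv d n n - of_nat n * binconv d (Suc n) n"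
proof -
  \<comment> \<open>The bracket in \<open>F\<close> is \<open>q\<close> with k replaced by k - 1, so
    \<open>F (Suc k)\<close> is a multiple of \<open>q k\<close>.\<close>
  define q where "q k = (x + 2 * of_nat n + 3) * of_nat ((2 * n - k) choose n)
    - of_nat n * of_nat ((2 * n + 1 - k) choose Suc n)" for k
  define F where "F k = - of_nat k * (of_nat k - 1) * p k *
    ((x + 2 * of_nat n + 3) * of_nat ((2 * n + 1 - k) choose n)
      - of_nat n * of_nat ((2 * n + 2 - k) choose Suc n))" for k
  have p_Suc: "of_nat (Suc k) * p (Suc k) = (x + of_nat k + 1) * p k" for k
    unfolding p_def by (rule gbinomial_diagonal_Suc)
  have F_Suc: "F (Suc k) = - of_nat k * p k * (x + of_nat k + 1) * q k" for k
  proof -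
    have "F (Suc k) = - (of_nat (Suc k) * p (Suc k)) * of_nat k * q k"
      by (simp add: F_def q_def algebra_simps)
    then show ?thesis by (simp only: p_Suc) (simp add: algebra_simps)
  qed
  \<comment> \<open>This removes both the upper boundary term and the last term of the sum by
    parts.\<close>
  have q_0: "q (Suc n) = 0"
    using n by (simp add: q_def binomial_eq_0)
  have step: "of_nat n * (x + of_nat n + 3) * (of_nat k * p k * of_nat ((Suc n + Suc n - k) choose Suc n))
      - (x + 2 * of_nat n + 3) * (x + 2 * of_nat n + 2) * (of_nat k * p k * of_nat ((2 * n - k) choose n))
      = F (Suc k) - F k" if k: "k \<le> Suc n" for k
  proof -
    obtain m where m: "n = Suc m" using n by (cases n) auto
    have e: "2 * n + 1 - k = Suc (2 * n - k)" "2 * n + 2 - k = Suc (Suc (2 * n - k))"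
      "Suc n + Suc n - k = Suc (Suc (2 * n - k))"
      using k n by auto
    obtain D :: complex where D:
      "of_nat ((2 * Suc m - k) choose Suc m) = (of_nat m + 2 - of_nat k) * (of_nat m + 2) * D"
      "of_nat (Suc (2 * Suc m - k) choose Suc m) = (2 * of_nat m + 3 - of_nat k) * (of_nat m + 2) * D"
      "of_nat (Suc (2 * Suc m - k) choose Suc (Suc m))
        = (2 * of_nat m + 3 - of_nat k) * (of_nat m + 2 - of_nat k) * D"
      "of_nat (Suc (Suc (2 * Suc m - k)) choose Suc (Suc m))
        = (2 * of_nat m + 4 - of_nat k) * (2 * of_nat m + 3 - of_nat k) * D"
      by (rule binomial_window[OF k[unfolded m]])
    show ?thesis
      unfolding F_Suc unfolding F_def q_def e unfolding m D of_nat_Suc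
      by algebra
  qed
  have "of_nat n * (x + of_nat n + 3) * binconv (\<lambda>k. of_nat k * p k * g k) (Suc n) (Suc n)
      - (x + 2 * of_nat n + 3) * (x + 2 * of_nat n + 2) * binconv (\<lambda>k. of_nat k * p k * g k) n n
      = (\<Sum>k\<le>Suc n. (F (Suc k) - F k) * g k)"
    unfolding binconv_diagonal_extend[OF n] unfolding binconv_def sum_distrib_left sum_subtractf[symmetric]
    by (intro sum.cong refl) (simp only: step[symmetric] atMost_iff, simp add: algebra_simps)
  also have "\<dots> = - (\<Sum>k\<le>Suc n. F (Suc k) * (g (Suc k) - g k))"
    by (subst sum_by_parts, subst F_Suc) (simp add: F_def q_0)
  also have "\<dots> = (\<Sum>k\<le>n. d k * q k)"
  proof -
    have "- (F (Suc k) * (g (Suc k) - g k)) = d k * q k" for k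
      unfolding F_Suc d_def by (simp add: algebra_simps)
    then show ?thesis
      by (simp only: sum_negf[symmetric]) (simp add: q_0)
  qed
  also have "\<dots> = (x + 2 * of_nat n + 3) * binconv d n n - of_nat n * binconv d (Suc n) n"
  proof -
    have "2 * n - k = n + n - k" "2 * n + 1 - k = Suc n + n - k" for k
      by simp_all
    then show ?thesis
      unfolding binconv_def sum_distrib_left sum_subtractf[symmetric] q_def
      by (simp only: right_diff_distrib mult.left_commute)
  qed
  finally show ?thesis .
qed

section \<open>Calculus of convolutions and closed forms with weight k\<close>

lemma binconv_cong:
  "(\<And>k. k \<le> N \<Longrightarrow> f k = g k) \<Longrightarrow> binconv f m N = binconv g m N"
  unfolding binconv_def by (intro sum.cong) auto

lemma binconv_add: "binconv (\<lambda>k. f k + g k) m N = binconv f m N + binconv g m N"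
  by (simp add: binconv_def distrib_right sum.distrib)

lemma binconv_cmult: "binconv (\<lambda>k. c * f k) m N = c * binconv f m N"
  by (simp add: binconv_def sum_distrib_left mult.assoc)

lemma binconv_shift:
  assumes "f 0 = 0"
  shows "binconv f m (Suc N) = binconv (\<lambda>k. f (Suc k)) m N"
  unfolding binconv_def by (subst sum.atMost_Suc_shift) (simp add: assms)

text \<open>Absorption in the kernel trades the lower index m + 1 for m and a linear weight, so that
  convolutions with the two kernels can be merged.\<close>

lemma binconv_Suc_left_absorb:
  "(of_nat m + 1) * binconv f (Suc m) N
    = binconv (\<lambda>k. (of_nat m + of_nat N + 1 - of_nat k) * f k) m N"
  unfolding binconv_def sum_distrib_left
proof (intro sum.cong refl)
  fix k assume "k \<in> {..N}"
  then have k: "Suc m + N - k = Suc (m + N - k)" "k \<le> m + N" by auto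
  have "(of_nat m + 1) * of_nat ((Suc m + N - k) choose Suc m)
      = ((of_nat m + of_nat N + 1 - of_nat k) * of_nat ((m + N - k) choose m) :: complex)"
  proof -
    have "(of_nat m + 1) * of_nat (Suc (m + N - k) choose Suc m)
        = ((of_nat (m + N - k) + 1) * of_nat ((m + N - k) choose m) :: complex)"
      using arg_cong[OF Suc_times_binomial_eq[of "m + N - k" m], of "of_nat :: nat \<Rightarrow> complex"]
      by (simp only: of_nat_mult of_nat_Suc mult.commute add.commute)
    then show ?thesis
      using k by (simp only: of_nat_diff of_nat_add diff_add_eq)
  qed
  then show "(of_nat m + 1) * (f k * of_nat ((Suc m + N - k) choose Suc m))
      = (of_nat m + of_nat N + 1 - of_nat k) * f k * of_nat ((m + N - k) choose m)"
    by (simp only: mult.left_commute[of _ "f k"] mult.assoc)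
qed

lemma binconv_linear_weight:
  "binconv (\<lambda>k. of_nat k * ((x + of_nat k) gchoose k)) m (Suc N)
    = (x + 1) * ((x + of_nat (m + N) + 2) gchoose N)"
proof -
  have "binconv (\<lambda>k. of_nat k * ((x + of_nat k) gchoose k)) m (Suc N)
      = (x + 1) * binconv (\<lambda>k. (x + 1 + of_nat k) gchoose k) m N"
    by (subst binconv_shift, simp) (simp only: gbinomial_diagonal_absorb binconv_cmult)
  then show ?thesis
    unfolding binconv_gbinomial by (simp add: add_ac)
qed

text \<open>After absorbing k, H_{k+1}(x) = 1/(x + 1) + H_k(x + 1) splits the sum into Vandermonde's
  convolution and its harmonic analogue, both at x + 1.\<close>

lemma binconv_linear_weight_gharm:
  assumes nz: "\<And>k. k \<in> {1..m + N + 2} \<Longrightarrow> x + of_nat k \<noteq> 0"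
  shows "binconv (\<lambda>k. of_nat k * ((x + of_nat k) gchoose k) * gharm1 k x) m (Suc N)
    = (x + 1) * ((x + of_nat (m + N) + 2) gchoose N)
      * (gharm1 (m + N + 2) x - gharm1 (m + 2) x + 1 / (x + 1))"
proof -
  have "binconv (\<lambda>k. of_nat k * ((x + of_nat k) gchoose k) * gharm1 k x) m (Suc N)
      = binconv (\<lambda>k. of_nat (Suc k) * ((x + of_nat (Suc k)) gchoose Suc k) * gharm1 (Suc k) x) m N"
    by (rule binconv_shift) simp
  also have "\<dots> = binconv (\<lambda>k. (x + 1) * ((1 / (x + 1)) * ((x + 1 + of_nat k) gchoose k)
      + ((x + 1 + of_nat k) gchoose k) * gharm1 k (x + 1))) m N"
    unfolding gbinomial_diagonal_absorb gharm_Suc_shift power_one_right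
    by (simp only: distrib_left mult_ac)
  also have "\<dots> = (x + 1) * (1 / (x + 1) * ((x + 1 + of_nat (m + N) + 1) gchoose N)
      + ((x + 1 + of_nat (m + N) + 1) gchoose N) * (gharm1 (m + N + 1) (x + 1) - gharm1 (m + 1) (x + 1)))"
  proof -
    have "x + 1 + of_nat k \<noteq> 0" if "k \<in> {1..m + N + 1}" for k
      using nz[of "Suc k"] that by (simp add: add_ac)
    then have "binconv (\<lambda>k. ((x + 1 + of_nat k) gchoose k) * gharm1 k (x + 1)) m N
      = ((x + 1 + of_nat (m + N) + 1) gchoose N) * (gharm1 (m + N + 1) (x + 1) - gharm1 (m + 1) (x + 1))"
      by (rule binconv_gbinomial_gharm)
    then show ?thesis
      by (simp only: binconv_cmult binconv_add binconv_gbinomial)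
  qed
  also have "\<dots> = (x + 1) * ((x + of_nat (m + N) + 2) gchoose N)
      * (gharm1 (m + N + 2) x - gharm1 (m + 2) x + 1 / (x + 1))"
  proof -
    have "gharm1 (m + N + 2) x - gharm1 (m + 2) x = gharm1 (m + N + 1) (x + 1) - gharm1 (m + 1) (x + 1)"
      by (simp add: gharm_Suc_shift)
    moreover have "x + 1 + of_nat (m + N) + 1 = x + of_nat (m + N) + 2"
      by simp
    moreover have "c * (r * P + P * h) = c * P * (h + r)" for c r P h :: complex
      by (simp add: algebra_simps)
    ultimately show ?thesis
      by (simp only:)
  qed
  finally show ?thesis .
qed

section \<open>The half-argument harmonic difference and the sum with reciprocal weight\<close>

text \<open>Gives the ratio of consecutive closed-form binomials: as n grows by 1, their upper
  argument grows by 2 and their lower index by 1.\<close>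

lemma gbinomial_add_2_Suc:
  fixes a :: "'a::field_char_0"
  shows "(of_nat k + 1) * (a + 1 - of_nat k) * ((a + 2) gchoose Suc k) = (a + 2) * (a + 1) * (a gchoose k)"
proof -
  have "(of_nat k + 1) * ((a + 2) gchoose Suc k) = (a + 2) * ((a + 1) gchoose k)"
    using gbinomial_factors[of "a + 1" k] by (simp add: field_simps del: of_nat_Suc) (simp add: algebra_simps)
  then have "(a + 1 - of_nat k) * ((of_nat k + 1) * ((a + 2) gchoose Suc k))
      = (a + 2) * ((a + 1 - of_nat k) * ((a + 1) gchoose k))"
    by (simp only: mult.left_commute)
  then show ?thesis
    unfolding gbinomial_add_1_upper by (simp only: mult_ac)
qed

text \<open>Equals twice the alternating sum 1/(x + 2) - 1/(x + 3) + ... - 1/(x + 2n + 1).\<close>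

definition gharm_gap :: "nat \<Rightarrow> complex \<Rightarrow> complex" where
  "gharm_gap n x = gharm1 n (x / 2) - gharm1 n ((x + 1) / 2)"

lemma gharm_gap_Suc:
  assumes "x + 2 * of_nat n + 2 \<noteq> 0" "x + 2 * of_nat n + 3 \<noteq> 0"
  shows "gharm_gap (Suc n) x = gharm_gap n x + 2 / ((x + 2 * of_nat n + 2) * (x + 2 * of_nat n + 3))"
proof -
  have *: "x / 2 + of_nat (Suc n) = (x + 2 * of_nat n + 2) / 2"
    "(x + 1) / 2 + of_nat (Suc n) = (x + 2 * of_nat n + 3) / 2"
    by (simp_all add: field_simps)
  have "gharm_gap (Suc n) x = gharm_gap n x + (2 / (x + 2 * of_nat n + 2) - 2 / (x + 2 * of_nat n + 3))"
    unfolding gharm_gap_def gharm_Suc * by simp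
  also have "2 / (x + 2 * of_nat n + 2) - 2 / (x + 2 * of_nat n + 3)
      = 2 / ((x + 2 * of_nat n + 2) * (x + 2 * of_nat n + 3))"
    using assms by (simp add: divide_simps)
  finally show ?thesis .
qed

text \<open>For g_k = 1/(x + k + 1) the product (x + k + 1)(x + k + 2)(g_{k+1} - g_k) is -1, so the
  inhomogeneity of \<open>binconv_recurrence\<close> is minus a Vandermonde sum.\<close>

lemma binconv_reciprocal_weight:
  assumes "n \<ge> 1" and "\<And>k. k \<in> {1..2 * n + 1} \<Longrightarrow> x + of_nat k \<noteq> 0"
  shows "binconv (\<lambda>k. ((x + of_nat k) gchoose k) * (1 / (x + of_nat k + 1))) n n
    = ((x + 2 * of_nat n + 1) gchoose n) * (1 / (x + 1) - gharm_gap n x / 2)"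
  using assms
proof (induction n rule: nat_induct_at_least)
  case base
  have "x + 1 \<noteq> 0" "x + 2 \<noteq> 0" "x + 3 \<noteq> 0"
    using base[of 1] base[of 2] base[of 3] by auto
  moreover from this have "gharm_gap 1 x = 2 / ((x + 2) * (x + 3))"
    using gharm_gap_Suc[of x 0] by (simp add: gharm_gap_def)
  moreover have "binconv (\<lambda>k. ((x + of_nat k) gchoose k) * (1 / (x + of_nat k + 1))) 1 1
      = 2 * (1 / (x + 1)) + (x + 1) * (1 / (x + 2))"
    by (simp add: binconv_def add_ac)
  moreover have "(x + 2 * of_nat 1 + 1) gchoose 1 = x + 3"
    by simp
  ultimately show ?case
    by (simp only:) (simp add: divide_simps, simp add: algebra_simps)
next
  case (Suc n)
  define p where "p k = (x + of_nat k) gchoose k" for k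
  define C where "C = (x + 2 * of_nat n + 1) gchoose n"
  define C' where "C' = (x + 2 * of_nat (Suc n) + 1) gchoose Suc n"
  define V where "V n = binconv (\<lambda>k. p k * (1 / (x + of_nat k + 1))) n n" for n
  define a b v where "a = x + 2 * of_nat n + 3" and "b = x + 2 * of_nat n + 2"
    and "v = 1 / (x + 1) - gharm_gap n x / 2"
  have nz: "x + of_nat k \<noteq> 0" if "1 \<le> k" "k \<le> 2 * n + 3" for k
    using Suc.prems[of k] that by simp
  have nz': "a \<noteq> 0" "b \<noteq> 0" "(of_nat n + 1) * (x + of_nat n + 2) \<noteq> 0"
    using nz[of "2 * n + 3"] nz[of "2 * n + 2"] nz[of "n + 2"] of_nat_neq_0[of n, where 'a = complex]
    unfolding a_def b_def by (simp_all add: add_ac del: of_nat_neq_0)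
  have "(of_nat n + 1) * (x + of_nat n + 2) * V (Suc n) - a * b * V n
      = binconv (\<lambda>k. p k * (x + of_nat k + 1) * (x + of_nat k + 2)
          * (1 / (x + of_nat (Suc k) + 1) - 1 / (x + of_nat k + 1))) n n"
    unfolding V_def p_def a_def b_def using Suc.hyps by (rule binconv_recurrence)
  also have "\<dots> = binconv (\<lambda>k. (- 1) * p k) n n"
  proof (rule binconv_cong)
    fix k assume "k \<le> n"
    then have "x + of_nat k + 1 \<noteq> 0" "x + of_nat k + 2 \<noteq> 0"
      using nz[of "k + 1"] nz[of "k + 2"] by (simp_all add: add_ac)
    moreover have "x + of_nat (Suc k) + 1 = x + of_nat k + 2" by simp
    ultimately show "p k * (x + of_nat k + 1) * (x + of_nat k + 2)
        * (1 / (x + of_nat (Suc k) + 1) - 1 / (x + of_nat k + 1)) = (- 1) * p k"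
      by (simp only:) (simp add: divide_simps)
  qed
  also have "\<dots> = - C"
    unfolding binconv_cmult p_def binconv_gbinomial C_def by simp
  finally have rec: "(of_nat n + 1) * (x + of_nat n + 2) * V (Suc n) = a * b * V n - C"
    by (simp add: algebra_simps)
  have "V n = C * v"
    unfolding V_def p_def C_def v_def using nz by (intro Suc.IH) auto
  then have "(of_nat n + 1) * (x + of_nat n + 2) * V (Suc n) = a * b * C * (v - 1 / (b * a))"
    unfolding rec using nz' by (simp add: field_simps)
  \<comment> \<open>\<open>C\<close> solves the homogeneous recurrence, so only the quotient
    \<open>v\<close> changes, by half an increment of \<open>gharm_gap\<close> with a minus
    sign.\<close>
  also have "a * b * C = (of_nat n + 1) * (x + of_nat n + 2) * C'"
    using gbinomial_add_2_Suc[of n "x + 2 * of_nat n + 1"]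
    unfolding C_def C'_def a_def b_def by (simp add: algebra_simps)
  finally have "V (Suc n) = C' * (v - 1 / (b * a))"
    unfolding mult.assoc[of "(of_nat n + 1) * (x + of_nat n + 2)"] mult_left_cancel[OF nz'(3)] .
  also have "v - 1 / (b * a) = 1 / (x + 1) - gharm_gap (Suc n) x / 2"
    using gharm_gap_Suc[of x n] nz' unfolding v_def a_def b_def by (simp add: add_divide_distrib)
  finally show ?case
    unfolding V_def p_def C'_def .
qed

text \<open>The increment of the expression in braces (divided by 8) from \<open>n\<close> to \<open>n + 1\<close>, compared with the
  inhomogeneity of the recurrence.\<close>

lemma increment_identity:
  fixes x n A B :: complex
  assumes "n \<noteq> 0" "n + 1 \<noteq> 0" "x + 1 \<noteq> 0"
    and "a = x + 2 * n + 3" "b = x + 2 * n + 2" "c = x + n + 3"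
    and "a \<noteq> 0" "b \<noteq> 0" "c \<noteq> 0"
  defines "A' \<equiv> A + 1 / c - 1 / b - 1 / a" and "B' \<equiv> B + 2 / (b * a)"
  shows "a * b * (1 / c\<^sup>2 - (1 / b\<^sup>2 + 1 / a\<^sup>2) / 2
      + A' * (A' - 2 / (x + 1)) - A * (A - 2 / (x + 1))
      - (B' * (B' + 4 / (n + 1)) - B * (B + 4 / n)) / 8)
    = 2 * (a * (1 / (x + 1) - A) - n * (b / c) * (1 / (x + 1) - A + 1 / b - 1 / c))
      + (n + (x + 3 * n + 3) * ((x + n + 2) / n) * B / 2) / (n + 1)"
proof -
  \<comment> \<open>In these variables the squares of A cancel and the increment of the A-part
    becomes linear in s.\<close>
  define s where "s = 1 / (x + 1) - A"
  define e where "e = 1 / c - 1 / b - 1 / a"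
  have A: "A' * (A' - 2 / (x + 1)) - A * (A - 2 / (x + 1)) = e\<^sup>2 - 2 * e * s"
  proof -
    have "A' = A + e" unfolding A'_def e_def by simp
    moreover have "2 / (x + 1) = 2 * (s + A)" by (simp add: s_def)
    ultimately show ?thesis
      by (simp only:) (simp add: algebra_simps power2_eq_square)
  qed
  have e: "a * b * e = n * (b / c) - a"
  proof -
    have n: "n = a - c" using assms by simp
    show ?thesis
      unfolding e_def n using assms(7-9) by (simp add: field_simps)
  qed
  have B: "a * b * ((B' * (B' + 4 / (n + 1)) - B * (B + 4 / n)) / 8)
      = 1 / (2 * (b * a)) + 1 / (n + 1) - (x + 3 * n + 3) * ((x + n + 2) / n) * B / 2 / (n + 1)"
  proof -
    have "a * b * ((B' * (B' + 4 / m) - B * (B + 4 / n)) / 8)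
        = 1 / (2 * (b * a)) + 1 / m + B / 2 * (1 - a * b * (1 / n - 1 / m))" if "m \<noteq> 0" for m
      unfolding B'_def using that assms(1,7,8)
      by (simp add: divide_simps) (simp add: algebra_simps)
    from this[OF assms(2)] have "a * b * ((B' * (B' + 4 / (n + 1)) - B * (B + 4 / n)) / 8)
        = 1 / (2 * (b * a)) + 1 / (n + 1) + B / 2 * (1 - a * b * (1 / n - 1 / (n + 1)))" .
    also have "1 / n - 1 / (n + 1) = 1 / (n * (n + 1))"
      using assms(1,2) by (simp add: divide_simps)
    also have "1 - a * b * (1 / (n * (n + 1))) = - ((x + 3 * n + 3) * (x + n + 2) / (n * (n + 1)))"
    proof -
      \<comment> \<open>Since a = b + 1, a b - n (n + 1) factors as (b - n)(b + n + 1).\<close>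
      have "n * (n + 1) - a * b = - ((x + 3 * n + 3) * (x + n + 2))"
        unfolding assms(4,5) by (simp add: algebra_simps)
      then show ?thesis
        using assms(1,2) by (simp add: divide_simps)
    qed
    finally show ?thesis
      by simp
  qed
  have C: "a * b * (1 / c\<^sup>2 - (1 / b\<^sup>2 + 1 / a\<^sup>2) / 2 + e\<^sup>2)
      = 2 * (- n * (b / c) * (1 / b - 1 / c)) + 1 + 1 / (2 * (b * a))"
  proof -
    have n: "n = a - c" and ab: "a = b + 1" using assms by simp_all
    \<comment> \<open>With n replaced by a - c, this is a homogeneous identity of degree 0 in
      independent a, b, c; a - b = 1 is inserted afterwards.\<close>
    have "a * b * (1 / c\<^sup>2 - (1 / b\<^sup>2 + 1 / a\<^sup>2) / 2 + e\<^sup>2)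
      = 2 * (- (a - c) * (b / c) * (1 / b - 1 / c)) + 1 + (a - b)\<^sup>2 / (2 * (b * a))"
      unfolding e_def using assms(7-9) by (simp add: field_simps power2_eq_square)
    then show ?thesis
      using n ab by simp
  qed
  have "a * b * (1 / c\<^sup>2 - (1 / b\<^sup>2 + 1 / a\<^sup>2) / 2
      + A' * (A' - 2 / (x + 1)) - A * (A - 2 / (x + 1))
      - (B' * (B' + 4 / (n + 1)) - B * (B + 4 / n)) / 8)
    = a * b * (1 / c\<^sup>2 - (1 / b\<^sup>2 + 1 / a\<^sup>2) / 2 + e\<^sup>2) - 2 * s * (a * b * e)
      - a * b * ((B' * (B' + 4 / (n + 1)) - B * (B + 4 / n)) / 8)"
    unfolding add_diff_eq[symmetric] A by (simp only: right_diff_distrib distrib_left) (simp add: mult_ac)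
  also have "\<dots> = 2 * (a * s - n * (b / c) * (s + 1 / b - 1 / c))
      + (n + (x + 3 * n + 3) * ((x + n + 2) / n) * B / 2) / (n + 1)"
  proof -
    have "n / (n + 1) = 1 - 1 / (n + 1)"
      using assms(2) by (simp add: field_simps)
    moreover have "2 * (- n * (b / c) * (1 / b - 1 / c)) + 1 + h - 2 * s * (n * (b / c) - a) - (h + m - T)
        = 2 * (a * s - n * (b / c) * (s + 1 / b - 1 / c)) + (1 - m + T)" for h m T
    proof -
      have "2 * (- y * w) + 1 + h - 2 * s * (y - a) - (h + m - T) = 2 * (a * s - y * (s + w)) + (1 - m + T)" for y w
        by (simp add: algebra_simps)
      from this[of "n * (b / c)" "1 / b - 1 / c"] show ?thesis
        by (simp only: add_diff_eq mult_minus_left)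
    qed
    ultimately show ?thesis
      unfolding e B C add_divide_distrib[of n] by (simp only:)
  qed
  finally show ?thesis
    unfolding s_def .
qed

section \<open>Solution of the weighted recurrence for squared harmonic numbers\<close>

theorem theorem8:
  fixes x :: complex and n :: nat
  assumes "n \<ge> 1"
    and "\<And>k. k \<in> {1..2 * n + 1} \<Longrightarrow> x + of_nat k \<noteq> 0"
  shows "(\<Sum>k = 0..n. of_nat ((2 * n - k) choose n) * ((x + of_nat k) gchoose k)
              * of_nat k * (gharm1 k x)\<^sup>2)
    = (x + 1) / 8 * ((x + 2 * of_nat n + 1) gchoose (n - 1)) *
      (8 * gharm 2 (n + 2) x - 4 * gharm 2 (2 * n) (x + 1)
       + 8 * (gharm1 (n + 2) x - gharm1 (2 * n + 1) x)
           * (gharm1 (n + 2) x - gharm1 (2 * n + 1) x - 2 / (x + 1))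
       - (gharm1 n (x / 2) - gharm1 n ((x + 1) / 2))
           * (gharm1 n (x / 2) - gharm1 n ((x + 1) / 2) + 4 / of_nat n))"
proof -
  define p where "p k = (x + of_nat k) gchoose k" for k
  define U where "U n = binconv (\<lambda>k. of_nat k * p k * (gharm1 k x)\<^sup>2) n n" for n
  define A where "A n = gharm1 (n + 2) x - gharm1 (2 * n + 1) x" for n
  define u where "u n = gharm 2 (n + 2) x - gharm 2 (2 * n) (x + 1) / 2
    + A n * (A n - 2 / (x + 1)) - gharm_gap n x * (gharm_gap n x + 4 / of_nat n) / 8" for n
  define K where "K n = (x + 2 * of_nat n + 1) gchoose (n - 1)" for n
  \<comment> \<open>\<open>(x + 1) * K n\<close> is the value of the sum for g = 1, and
    \<open>u n\<close> is the expression in braces divided by 8.\<close>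
  have "U n = (x + 1) * K n * u n"
    using assms
  proof (induction n rule: nat_induct_at_least)
    case base
    have nz: "x + 1 \<noteq> 0" "x + 2 \<noteq> 0" "x + 3 \<noteq> 0"
      using base[of 1] base[of 2] base[of 3] by auto
    have gap: "gharm_gap 1 x = 2 / ((x + 2) * (x + 3))"
      using gharm_gap_Suc[of x 0] nz by (simp add: gharm_gap_def)
    define s t where "s = 1 / (x + 2)" and "t = 1 / (x + 3)"
    \<comment> \<open>This makes the second-order harmonic terms cancel against the
      \<open>gharm_gap\<close> terms in \<open>u 1\<close>.\<close>
    have st: "s - t = s * t"
      unfolding s_def t_def using nz by (simp add: divide_simps)
    have "gharm 2 (1 + 2) x = 1 / (x + 1)\<^sup>2 + s\<^sup>2 + t\<^sup>2" "gharm 2 (2 * 1) (x + 1) = s\<^sup>2 + t\<^sup>2"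
      by (simp_all add: s_def t_def gharm_def numeral_2_eq_2 numeral_3_eq_3 power_divide add_ac)
    moreover have "gharm_gap 1 x = 2 * (s * t)"
      unfolding gap s_def t_def by simp
    moreover have "A 1 = 0"
      by (simp add: A_def numeral_3_eq_3)
    ultimately have "u 1 = 1 / (x + 1)\<^sup>2 + ((s - t)\<^sup>2 - (s * t)\<^sup>2) / 2"
      unfolding u_def by (simp add: field_simps power2_eq_square)
    then have "u 1 = 1 / (x + 1)\<^sup>2"
      unfolding st by simp
    moreover have "U 1 = 1 / (x + 1)" "K 1 = 1"
      using nz by (simp_all add: U_def K_def p_def binconv_def gharm_def power2_eq_square)
    ultimately show ?case
      using nz by (simp add: power2_eq_square)
  next
    case (Suc n)
    then obtain N where N: "n = Suc N"
      by (cases n) auto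
    define a b c where "a = x + 2 * of_nat n + 3" and "b = x + 2 * of_nat n + 2" and "c = x + of_nat n + 3"
    define q where "q k = of_nat k * p k * (1 / (x + of_nat k + 1))" for k
    define d where "d k = of_nat k * p k * (x + of_nat k + 1) * ((gharm1 (Suc k) x)\<^sup>2 - (gharm1 k x)\<^sup>2)" for k
    have nz: "x + of_nat k \<noteq> 0" if "1 \<le> k" "k \<le> 2 * n + 3" for k
      using Suc.prems[of k] that by simp
    have n0: "(of_nat n :: complex) \<noteq> 0" "of_nat n + 1 \<noteq> (0 :: complex)"
      using Suc.hyps of_nat_neq_0[of n, where 'a = complex] by (simp_all add: add_ac del: of_nat_neq_0)
    have nz': "a \<noteq> 0" "b \<noteq> 0" "c \<noteq> 0" "x + 1 \<noteq> 0"
      using nz[of "2 * n + 3"] nz[of "2 * n + 2"] nz[of "n + 3"] nz[of 1]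
      unfolding a_def b_def c_def by (simp_all add: add_ac)
    have K': "of_nat n * c * K (Suc n) = a * b * K n"
      using gbinomial_add_2_Suc[of N "x + 2 * of_nat n + 1"]
      unfolding K_def a_def b_def c_def N by (simp add: algebra_simps)
    have d_split: "binconv d m n = 2 * binconv (\<lambda>k. of_nat k * p k * gharm1 k x) m n + binconv q m n" for m
    proof -
      have "binconv d m n = binconv (\<lambda>k. 2 * (of_nat k * p k * gharm1 k x) + q k) m n"
      proof (rule binconv_cong)
        fix k assume "k \<le> n"
        then have k: "x + of_nat k + 1 \<noteq> 0"
          using nz[of "k + 1"] by (simp add: add_ac)
        define r where "r = 1 / (x + of_nat k + 1)"
        have H_Suc: "gharm1 (Suc k) x = gharm1 k x + r"
          by (simp add: gharm_Suc r_def add_ac)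
        have "d k = of_nat k * p k * ((x + of_nat k + 1) * r) * (2 * gharm1 k x + r)"
          unfolding d_def H_Suc by (simp add: algebra_simps power2_eq_square)
        also have "(x + of_nat k + 1) * r = 1"
          using k by (simp add: r_def)
        finally show "d k = 2 * (of_nat k * p k * gharm1 k x) + q k"
          unfolding q_def r_def[symmetric] by (simp add: algebra_simps)
      qed
      then show ?thesis
        by (simp only: binconv_add binconv_cmult)
    qed
    have H1: "binconv (\<lambda>k. of_nat k * p k * gharm1 k x) n n = (x + 1) * K n * (1 / (x + 1) - A n)"
    proof -
      have e: "x + of_nat (n + N) + 2 = x + 2 * of_nat n + 1" "n + N + 2 = 2 * n + 1"
        by (simp_all add: N)
      have "binconv (\<lambda>k. of_nat k * p k * gharm1 k x) n (Suc N)
        = (x + 1) * ((x + of_nat (n + N) + 2) gchoose N)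
          * (gharm1 (n + N + 2) x - gharm1 (n + 2) x + 1 / (x + 1))"
        unfolding p_def by (rule binconv_linear_weight_gharm, rule nz) (auto simp: N)
      moreover have "K n = (x + 2 * of_nat n + 1) gchoose N"
        by (simp add: K_def N)
      ultimately show ?thesis
        unfolding e A_def N[symmetric] by (simp add: algebra_simps)
    qed
    \<comment> \<open>Compared with \<open>H1\<close>, the upper argument of the binomial grows by
      1, which gives the factor b/c, and each harmonic number gains one term.\<close>
    have H2: "binconv (\<lambda>k. of_nat k * p k * gharm1 k x) (Suc n) n
        = (x + 1) * (b / c * K n) * (1 / (x + 1) - A n + 1 / b - 1 / c)"
    proof -
      have "c * ((x + 2 * of_nat n + 2) gchoose N) = b * K n"
        using gbinomial_add_1_upper[of "x + 2 * of_nat n + 1" N]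
        unfolding K_def b_def c_def N by (simp add: add_ac)
      then have "(x + of_nat (Suc n + N) + 2) gchoose N = b / c * K n"
        using nz' by (simp add: N field_simps)
      moreover have "gharm1 (Suc n + N + 2) x - gharm1 (Suc n + 2) x = 1 / b - 1 / c - A n"
      proof -
        have "gharm1 (Suc n + N + 2) x = gharm1 (2 * n + 1) x + 1 / b"
        proof -
          have "Suc n + N + 2 = Suc (2 * n + 1)" by (simp add: N)
          then show ?thesis
            by (simp only: gharm_Suc) (simp add: b_def add_ac)
        qed
        moreover have "gharm1 (Suc n + 2) x = gharm1 (n + 2) x + 1 / c"
          using gharm_Suc[of 1 "n + 2" x] by (simp add: c_def add_ac)
        ultimately show ?thesis by (simp add: A_def)
      qed
      moreover have "binconv (\<lambda>k. of_nat k * p k * gharm1 k x) (Suc n) (Suc N)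
        = (x + 1) * ((x + of_nat (Suc n + N) + 2) gchoose N)
          * (gharm1 (Suc n + N + 2) x - gharm1 (Suc n + 2) x + 1 / (x + 1))"
        unfolding p_def by (rule binconv_linear_weight_gharm, rule nz) (auto simp: N)
      ultimately show ?thesis
        by (simp add: N[symmetric] add_ac)
    qed
    have Q: "a * binconv q n n - of_nat n * binconv q (Suc n) n
        = (x + 1) * K n * (of_nat n + (x + 3 * of_nat n + 3) * ((x + of_nat n + 2) / of_nat n) * gharm_gap n x / 2)
          / (of_nat n + 1)"
    proof -
      define C where "C = (x + 2 * of_nat n + 1) gchoose n"
      have C: "C = (x + of_nat n + 2) / of_nat n * K n"
        using gbinomial_Suc_lower[of N "x + 2 * of_nat n + 1"] n0
        unfolding C_def K_def N by (simp add: field_simps)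
      \<comment> \<open>The second identity is k/(x + k + 1) = 1 - (x + 1)/(x + k + 1). In the
        resulting sum the \<open>C\<close> from Vandermonde cancels, leaving only the
        \<open>gharm_gap\<close> term.\<close>
      have q: "(x + of_nat k + 1) * q k = of_nat k * p k" "q k = p k + (- (x + 1)) * (p k * (1 / (x + of_nat k + 1)))"
        if "k \<le> n" for k
      proof -
        have "x + of_nat k + 1 \<noteq> 0"
          using nz[of "k + 1"] that by (simp add: add_ac)
        then show "(x + of_nat k + 1) * q k = of_nat k * p k"
          "q k = p k + (- (x + 1)) * (p k * (1 / (x + of_nat k + 1)))"
          unfolding q_def by (simp_all add: field_simps)
      qed
      have "binconv q n n = binconv (\<lambda>k. p k + (- (x + 1)) * (p k * (1 / (x + of_nat k + 1)))) n n"
        by (rule binconv_cong) (rule q(2))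
      also have "\<dots> = C + (- (x + 1)) * (C * (1 / (x + 1) - gharm_gap n x / 2))"
      proof -
        have "binconv p n n = C"
          unfolding p_def binconv_gbinomial C_def by simp
        moreover have "binconv (\<lambda>k. p k * (1 / (x + of_nat k + 1))) n n = C * (1 / (x + 1) - gharm_gap n x / 2)"
          unfolding p_def C_def using Suc.hyps by (rule binconv_reciprocal_weight) (rule nz, auto)
        ultimately show ?thesis
          by (simp only: binconv_add binconv_cmult)
      qed
      also have "\<dots> = (x + 1) * C * gharm_gap n x / 2"
      proof -
        have split: "C + (- y) * (C * (r - g / 2)) = C * (1 - y * r) + y * C * g / 2" for y r g
          by (simp add: algebra_simps)
        show ?thesis
          unfolding split using nz'(4) by simp
      qed
      finally have qn: "binconv q n n = (x + 1) * C * gharm_gap n x / 2" .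
      have kp: "binconv (\<lambda>k. of_nat k * p k) n n = (x + 1) * K n"
        using binconv_linear_weight[of x n N] unfolding p_def K_def by (simp add: N)
      \<comment> \<open>The factor n + 1 permits absorption, which brings both convolutions to the
        kernel with lower index n.\<close>
      have "(of_nat n + 1) * (a * binconv q n n - of_nat n * binconv q (Suc n) n)
          = (of_nat n + 1) * a * binconv q n n - of_nat n * ((of_nat n + 1) * binconv q (Suc n) n)"
        by (simp add: algebra_simps)
      also have "\<dots> = binconv (\<lambda>k. (of_nat n + 1) * a * q k
          + (- of_nat n) * ((of_nat n + of_nat n + 1 - of_nat k) * q k)) n n"
        unfolding binconv_Suc_left_absorb binconv_add binconv_cmult by simp
      \<comment> \<open>The coefficient (n + 1) a - n (2n + 1 - k) of \<open>q k\<close> equals n (x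
        + k + 1) + (x + 3n + 3), and x + k + 1 cancels the denominator of
        \<open>q k\<close>.\<close>
      also have "\<dots> = binconv (\<lambda>k. of_nat n * (of_nat k * p k) + (x + 3 * of_nat n + 3) * q k) n n"
        by (rule binconv_cong) (simp only: q(1)[symmetric] a_def, simp add: algebra_simps)
      also have "\<dots> = of_nat n * ((x + 1) * K n) + (x + 3 * of_nat n + 3) * ((x + 1) * C * gharm_gap n x / 2)"
        by (simp only: binconv_add binconv_cmult kp qn)
      also have "\<dots> = (x + 1) * K n * (of_nat n
          + (x + 3 * of_nat n + 3) * ((x + of_nat n + 2) / of_nat n) * gharm_gap n x / 2)"
        unfolding C distrib_left by simp
      finally show ?thesis
        using n0 by (simp only: nonzero_eq_divide_eq mult.commute not_False_eq_True)
    qed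
    have "of_nat n * c * U (Suc n) - a * b * U n = a * binconv d n n - of_nat n * binconv d (Suc n) n"
      unfolding U_def d_def p_def a_def b_def c_def using Suc.hyps by (rule binconv_recurrence_weighted)
    also have "\<dots> = (x + 1) * K n * (2 * (a * (1 / (x + 1) - A n)
        - of_nat n * (b / c) * (1 / (x + 1) - A n + 1 / b - 1 / c))
      + (of_nat n + (x + 3 * of_nat n + 3) * ((x + of_nat n + 2) / of_nat n) * gharm_gap n x / 2) / (of_nat n + 1))"
    proof -
      have "a * binconv d n n - of_nat n * binconv d (Suc n) n
        = 2 * (a * binconv (\<lambda>k. of_nat k * p k * gharm1 k x) n n
          - of_nat n * binconv (\<lambda>k. of_nat k * p k * gharm1 k x) (Suc n) n)
         + (a * binconv q n n - of_nat n * binconv q (Suc n) n)"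
        unfolding d_split by (simp add: algebra_simps)
      also have "\<dots> = (x + 1) * K n * (2 * (a * (1 / (x + 1) - A n)
          - of_nat n * (b / c) * (1 / (x + 1) - A n + 1 / b - 1 / c)))
         + (x + 1) * K n * ((of_nat n + (x + 3 * of_nat n + 3) * ((x + of_nat n + 2) / of_nat n) * gharm_gap n x / 2)
          / (of_nat n + 1))"
      proof -
        have "2 * (a * (y * k * s) - m * (y * (g * k) * t)) + y * k * z / w
            = y * k * (2 * (a * s - m * g * t)) + y * k * (z / w)" for y k s m g t z w :: complex
          by (simp add: algebra_simps)
        then show ?thesis
          unfolding H1 H2 Q .
      qed
      finally show ?thesis
        by (simp only: distrib_left)
    qed
    also have "\<dots> = (x + 1) * K n * (a * b * (u (Suc n) - u n))"
    proof -
      have "gharm 2 (Suc n + 2) x = gharm 2 (n + 2) x + 1 / c\<^sup>2"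
        using gharm_Suc[of 2 "n + 2" x] by (simp add: c_def add_ac)
      moreover have "gharm 2 (2 * Suc n) (x + 1) = gharm 2 (2 * n) (x + 1) + (1 / b\<^sup>2 + 1 / a\<^sup>2)"
        using gharm_Suc[of 2 "2 * n + 1" "x + 1"] gharm_Suc[of 2 "2 * n" "x + 1"]
        by (simp add: a_def b_def add_ac)
      moreover have A': "A (Suc n) = A n + 1 / c - 1 / b - 1 / a"
      proof -
        have "gharm1 (Suc n + 2) x = gharm1 (n + 2) x + 1 / c"
          using gharm_Suc[of 1 "n + 2" x] by (simp add: c_def add_ac)
        moreover have "gharm1 (2 * Suc n + 1) x = gharm1 (2 * n + 1) x + 1 / b + 1 / a"
          using gharm_Suc[of 1 "2 * n + 2" x] gharm_Suc[of 1 "2 * n + 1" x]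
          by (simp add: a_def b_def add_ac)
        ultimately show ?thesis by (simp add: A_def)
      qed
      moreover have B': "gharm_gap (Suc n) x = gharm_gap n x + 2 / (b * a)"
        unfolding a_def b_def using nz' by (intro gharm_gap_Suc) (auto simp: a_def b_def)
      moreover have "(of_nat (Suc n) :: complex) = of_nat n + 1" by simp
      ultimately have "u (Suc n) - u n = 1 / c\<^sup>2 - (1 / b\<^sup>2 + 1 / a\<^sup>2) / 2
          + A (Suc n) * (A (Suc n) - 2 / (x + 1)) - A n * (A n - 2 / (x + 1))
          - (gharm_gap (Suc n) x * (gharm_gap (Suc n) x + 4 / (of_nat n + 1))
            - gharm_gap n x * (gharm_gap n x + 4 / of_nat n)) / 8"
        unfolding u_def by (simp only: add_divide_distrib diff_divide_distrib) simp
      then show ?thesis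
        unfolding A' B' using increment_identity[OF n0 nz'(4) a_def b_def c_def nz'(1-3), of "A n" "gharm_gap n x"]
        by (simp only:)
    qed
    finally have "of_nat n * c * U (Suc n) = a * b * U n + (x + 1) * K n * (a * b * (u (Suc n) - u n))"
      by (simp add: algebra_simps)
    \<comment> \<open>The induction hypothesis cancels \<open>u n\<close>; the remaining factor
      \<open>a * b * K n\<close> is the homogeneous step to \<open>K (Suc n)\<close>.\<close>
    also have "\<dots> = (x + 1) * (a * b * K n) * u (Suc n)"
    proof -
      have "U n = (x + 1) * K n * u n"
        using nz by (intro Suc.IH) auto
      then show ?thesis by (simp add: algebra_simps)
    qed
    also have "\<dots> = of_nat n * c * ((x + 1) * K (Suc n) * u (Suc n))"
      unfolding K'[symmetric] by (simp only: mult_ac)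
    finally show ?case
      using n0 nz' by simp
  qed
  moreover have "U n = (\<Sum>k = 0..n. of_nat ((2 * n - k) choose n) * ((x + of_nat k) gchoose k)
      * of_nat k * (gharm1 k x)\<^sup>2)"
  proof -
    have "n + n = 2 * n" by simp
    then show ?thesis
      unfolding U_def binconv_def p_def by (simp only: atMost_atLeast0 mult_ac)
  qed
  moreover have "y * k * (h - h' / 2 + r * (r - e) - g * (g + f) / 8)
      = y / 8 * k * (8 * h - 4 * h' + 8 * r * (r - e) - g * (g + f))" for y k h h' r e g f :: complex
    by (simp add: field_simps)
  ultimately show ?thesis
    unfolding K_def u_def A_def gharm_gap_def by (simp only:)
qed

end
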